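(* Let $X=L^\infty[-1,1]$ and define $T:X\to X$ by $(Tx)(t)=0$ for $t\le 0$ and $(Tx)(t)=x(t)+x(-t)$ for $t>0$. Then $T$ is positive and satisfies condition $(\beta_+)$, but $T$ does not satisfy condition $(\beta)$.
   Context: For a subset $A$ of a vector lattice $X$, $A^d=\{x\in X: |x|\wedge|a|=0 \text{ for all } a\in A\}$ and $A^{dd}=(A^d)^d$. For $a,b\in X$ we write $a\lhd b$ if $\{a\}^{dd}\subseteq\{b\}^{dd}$. A linear operator $T$ satisfies condition $(\beta)$ if $Ta\lhd Tb$ whenever $a\lhd b$; it satisfies condition $(\beta_+)$ if $Ta\lhd Tb$ whenever $a\lhd b$ with $a,b\ge 0$. *)

theory Defs
  imports "HOL-Analysis.Analysis"
begin

text \<open>The measure space [-1,1] with Lebesgue measure.\<close>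
definition MI :: "real measure" where
  "MI = restrict_space lebesgue {-1..1}"

text \<open>Representatives of elements of L-infinity[-1,1]: measurable, essentially bounded.
  Elements of the vector lattice are the classes modulo a.e. equality; all
  notions below are invariant under a.e. equality.\<close>
definition Linf :: "(real \<Rightarrow> real) set" where
  "Linf = {x. x \<in> borel_measurable MI \<and> (\<exists>C. AE t in MI. \<bar>x t\<bar> \<le> C)}"

definition ae_eq :: "(real \<Rightarrow> real) \<Rightarrow> (real \<Rightarrow> real) \<Rightarrow> bool" where
  "ae_eq x y \<longleftrightarrow> (AE t in MI. x t = y t)"

text \<open>Order: x \<ge> 0 in L-infinity.\<close>
definition nonneg :: "(real \<Rightarrow> real) \<Rightarrow> bool" where
  "nonneg x \<longleftrightarrow> (AE t in MI. 0 \<le> x t)"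

text \<open>Disjointness: |x| inf |a| = 0 in L-infinity.\<close>
definition disj :: "(real \<Rightarrow> real) \<Rightarrow> (real \<Rightarrow> real) \<Rightarrow> bool" where
  "disj x a \<longleftrightarrow> ae_eq (\<lambda>t. min \<bar>x t\<bar> \<bar>a t\<bar>) (\<lambda>t. 0)"

definition dis :: "(real \<Rightarrow> real) set \<Rightarrow> (real \<Rightarrow> real) set" where
  "dis A = {x \<in> Linf. \<forall>a\<in>A. disj x a}"

definition ddis :: "(real \<Rightarrow> real) set \<Rightarrow> (real \<Rightarrow> real) set" where
  "ddis A = dis (dis A)"

text \<open>a \<lhd> b iff {a}^dd \<subseteq> {b}^dd.\<close>
definition lhd :: "(real \<Rightarrow> real) \<Rightarrow> (real \<Rightarrow> real) \<Rightarrow> bool" where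
  "lhd a b \<longleftrightarrow> ddis {a} \<subseteq> ddis {b}"

definition cond_beta :: "((real \<Rightarrow> real) \<Rightarrow> (real \<Rightarrow> real)) \<Rightarrow> bool" where
  "cond_beta S \<longleftrightarrow> (\<forall>a\<in>Linf. \<forall>b\<in>Linf. lhd a b \<longrightarrow> lhd (S a) (S b))"

definition cond_beta_plus :: "((real \<Rightarrow> real) \<Rightarrow> (real \<Rightarrow> real)) \<Rightarrow> bool" where
  "cond_beta_plus S \<longleftrightarrow> (\<forall>a\<in>Linf. \<forall>b\<in>Linf. nonneg a \<longrightarrow> nonneg b \<longrightarrow>
      lhd a b \<longrightarrow> lhd (S a) (S b))"

definition positive_op :: "((real \<Rightarrow> real) \<Rightarrow> (real \<Rightarrow> real)) \<Rightarrow> bool" where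
  "positive_op S \<longleftrightarrow> (\<forall>x\<in>Linf. nonneg x \<longrightarrow> nonneg (S x))"

text \<open>The operator T.\<close>
definition Top :: "(real \<Rightarrow> real) \<Rightarrow> (real \<Rightarrow> real)" where
  "Top x = (\<lambda>t. if t \<le> 0 then 0 else x t + x (-t))"

end

theory Submission
  imports Defs
begin

(* In L-infinity the band generated by a consists of the functions vanishing a.e. on the zero
   set of a, so a \<lhd> b says that a vanishes a.e. where b does.  T only involves a function at t
   and at -t, and reflection preserves null sets, so such a.e. inclusions are transported by T.
   For b \<ge> 0 the value (T b)(t) = b t + b (-t) vanishes only if both summands vanish, which then
   forces (T a)(t) = 0 whenever a \<lhd> b.  Without positivity the summands may cancel: the sign
   function b has the same band as 1, but T b = 0 while T 1 = 2 on (0, 1]. *)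

lemma AE_MI_iff_AE_lborel: "(AE t in MI. P t) \<longleftrightarrow> (AE t in lborel. t \<in> {-1..1} \<longrightarrow> P t)"
  unfolding MI_def by (simp add: AE_restrict_space_iff AE_completion_iff)

lemma AE_lborel_uminus:
  fixes P :: "real \<Rightarrow> bool"
  assumes "AE t in lborel. P t"
  shows "AE t in lborel. P (- t)"
proof -
  obtain N where N: "N \<in> null_sets lborel" "{t \<in> space lborel. \<not> P t} \<subseteq> N"
    using assms unfolding eventually_ae_filter by blast
  then have [measurable]: "N \<in> sets borel"
    using null_setsD2 by force
  have "AE t in lborel. 0 + (-1) * t \<notin> N"
    by (rule AE_borel_affine) (simp_all add: AE_not_in N)
  then show ?thesis
    by (rule eventually_mono) (use N in auto)
qed

lemma AE_MI_uminus:
  assumes "AE t in MI. P t"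
  shows "AE t in MI. P (- t)"
proof -
  have "AE t in lborel. t \<in> {-1..1} \<longrightarrow> P t"
    using assms by (simp add: AE_MI_iff_AE_lborel)
  then have "AE t in lborel. - t \<in> {-1..1} \<longrightarrow> P (- t)"
    by (rule AE_lborel_uminus)
  then show ?thesis
    unfolding AE_MI_iff_AE_lborel by eventually_elim auto
qed

lemma measurable_uminus_MI: "uminus \<in> MI \<rightarrow>\<^sub>M MI"
  unfolding MI_def
proof (rule measurable_restrict_space3)
  have "(uminus :: real \<Rightarrow> real) = (*\<^sub>R) (-1)"
    by (simp add: fun_eq_iff)
  then show "(uminus :: real \<Rightarrow> real) \<in> lebesgue \<rightarrow>\<^sub>M lebesgue"
    by (metis lebesgue_measurable_scaling)
qed auto

lemma borel_measurable_MI_reflect: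
  "x \<in> borel_measurable MI \<Longrightarrow> (\<lambda>t. x (- t)) \<in> borel_measurable MI"
  using measurable_compose[OF measurable_uminus_MI] by blast

lemma borel_measurable_MI_ident [measurable]: "(\<lambda>t. t) \<in> borel_measurable MI"
  unfolding MI_def by (intro measurable_restrict_space1 measurable_completion) simp

lemma LinfI:
  assumes "x \<in> borel_measurable MI" and "AE t in MI. \<bar>x t\<bar> \<le> C"
  shows "x \<in> Linf"
  using assms unfolding Linf_def by blast

lemma disj_iff_AE: "disj x a \<longleftrightarrow> (AE t in MI. x t = 0 \<or> a t = 0)"
  unfolding disj_def ae_eq_def by (rule AE_cong) (auto simp: min_def)

lemma zero_set_indicator_Linf:
  assumes "a \<in> Linf"
  shows "(\<lambda>t. if a t = 0 then 1 else 0 :: real) \<in> Linf"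
proof (rule LinfI[where C = 1])
  have [measurable]: "a \<in> borel_measurable MI"
    using assms by (simp add: Linf_def)
  show "(\<lambda>t. if a t = 0 then 1 else 0 :: real) \<in> borel_measurable MI"
    by measurable
qed (rule AE_I2, simp)

lemma ddis_singleton_iff:
  assumes "a \<in> Linf"
  shows "y \<in> ddis {a} \<longleftrightarrow> y \<in> Linf \<and> (AE t in MI. a t = 0 \<longrightarrow> y t = 0)"
proof
  assume y: "y \<in> ddis {a}"
  let ?z = "\<lambda>t. if a t = 0 then 1 else 0 :: real"
  have "?z \<in> dis {a}"
    using zero_set_indicator_Linf[OF assms] by (simp add: dis_def disj_iff_AE)
  with y have "y \<in> Linf" and "AE t in MI. y t = 0 \<or> ?z t = 0"
    by (auto simp: ddis_def dis_def disj_iff_AE)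
  then show "y \<in> Linf \<and> (AE t in MI. a t = 0 \<longrightarrow> y t = 0)"
    by (auto elim: eventually_mono split: if_splits)
next
  assume y: "y \<in> Linf \<and> (AE t in MI. a t = 0 \<longrightarrow> y t = 0)"
  have "disj y x" if "x \<in> dis {a}" for x
  proof -
    have "AE t in MI. x t = 0 \<or> a t = 0"
      using that by (simp add: dis_def disj_iff_AE)
    with y show ?thesis
      unfolding disj_iff_AE by (auto elim: eventually_rev_mp)
  qed
  with y show "y \<in> ddis {a}"
    by (auto simp: ddis_def dis_def)
qed

lemma lhd_iff_AE:
  assumes "a \<in> Linf" "b \<in> Linf"
  shows "lhd a b \<longleftrightarrow> (AE t in MI. b t = 0 \<longrightarrow> a t = 0)"
proof
  assume "lhd a b"
  moreover have "a \<in> ddis {a}"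
    using assms by (simp add: ddis_singleton_iff)
  ultimately have "a \<in> ddis {b}"
    unfolding lhd_def by blast
  then show "AE t in MI. b t = 0 \<longrightarrow> a t = 0"
    using assms(2) ddis_singleton_iff by blast
next
  assume "AE t in MI. b t = 0 \<longrightarrow> a t = 0"
  then show "lhd a b"
    using assms unfolding lhd_def by (auto simp: ddis_singleton_iff elim: eventually_rev_mp)
qed

lemma Top_Linf:
  assumes "x \<in> Linf"
  shows "Top x \<in> Linf"
proof -
  obtain C where x_meas: "x \<in> borel_measurable MI" and C: "AE t in MI. \<bar>x t\<bar> \<le> C"
    using assms by (auto simp: Linf_def)
  have [measurable]: "(\<lambda>t. x (- t)) \<in> borel_measurable MI"
    using x_meas by (rule borel_measurable_MI_reflect)
  have "(\<lambda>t. if t \<le> 0 then 0 else x t + x (- t)) \<in> borel_measurable MI"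
    using x_meas by measurable
  moreover have "AE t in MI. \<bar>Top x t\<bar> \<le> 2 * C"
    using C AE_MI_uminus[OF C] by eventually_elim (auto simp: Top_def)
  ultimately show ?thesis
    unfolding Top_def by (rule LinfI)
qed

lemma Top_ae_eq:
  assumes "ae_eq x y"
  shows "ae_eq (Top x) (Top y)"
proof -
  have eq: "AE t in MI. x t = y t"
    using assms by (simp add: ae_eq_def)
  with AE_MI_uminus[OF eq] show ?thesis
    unfolding ae_eq_def by eventually_elim (simp add: Top_def)
qed

lemma positive_op_Top: "positive_op Top"
  unfolding positive_op_def nonneg_def
proof (intro ballI impI)
  fix x :: "real \<Rightarrow> real"
  assume pos: "AE t in MI. 0 \<le> x t"
  with AE_MI_uminus[OF pos] show "AE t in MI. 0 \<le> Top x t"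
    by eventually_elim (simp add: Top_def)
qed

lemma cond_beta_plus_Top: "cond_beta_plus Top"
  unfolding cond_beta_plus_def
proof (intro ballI impI)
  fix a b
  assume a: "a \<in> Linf" and b: "b \<in> Linf" and "nonneg b" and "lhd a b"
  then have pos: "AE t in MI. 0 \<le> b t" and supp: "AE t in MI. b t = 0 \<longrightarrow> a t = 0"
    by (simp_all add: nonneg_def lhd_iff_AE)
  have "AE t in MI. Top b t = 0 \<longrightarrow> Top a t = 0"
    using pos supp AE_MI_uminus[OF pos] AE_MI_uminus[OF supp]
    by eventually_elim (auto simp: Top_def)
  then show "lhd (Top a) (Top b)"
    using a b by (simp add: lhd_iff_AE Top_Linf)
qed

lemma not_cond_beta_Top: "\<not> cond_beta Top"
proof
  assume beta: "cond_beta Top"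
  define sgn_fun :: "real \<Rightarrow> real" where "sgn_fun = (\<lambda>t. if t < 0 then -1 else 1)"
  have one_Linf: "(\<lambda>_. 1) \<in> Linf"
    by (rule LinfI[where C = 1]) simp_all
  have "sgn_fun \<in> borel_measurable MI"
    unfolding sgn_fun_def by measurable
  then have "sgn_fun \<in> Linf"
    by (rule LinfI[where C = 1]) (simp add: sgn_fun_def)
  moreover have "lhd (\<lambda>_. 1) sgn_fun"
    using one_Linf \<open>sgn_fun \<in> Linf\<close> by (simp add: lhd_iff_AE sgn_fun_def)
  ultimately have "AE t in MI. Top sgn_fun t = 0 \<longrightarrow> Top (\<lambda>_. 1) t = 0"
    using beta one_Linf by (simp add: cond_beta_def lhd_iff_AE Top_Linf)
  then have "AE t in lborel. t \<notin> {0<..1::real}"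
    unfolding AE_MI_iff_AE_lborel by eventually_elim (auto simp: Top_def sgn_fun_def)
  then have "{0<..1::real} \<in> null_sets lborel"
    by (simp add: AE_iff_null_sets)
  then show False
    by (simp add: null_sets_def)
qed

theorem mainTheorem15:
  shows "(\<forall>x\<in>Linf. Top x \<in> Linf)
    \<and> (\<forall>x\<in>Linf. \<forall>y\<in>Linf. ae_eq x y \<longrightarrow> ae_eq (Top x) (Top y))
    \<and> positive_op Top \<and> cond_beta_plus Top \<and> \<not> cond_beta Top"
  using Top_Linf Top_ae_eq positive_op_Top cond_beta_plus_Top not_cond_beta_Top by blast

end
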